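(* For every integer $n\ge 6$, $MB(\overline{P_n})=3$. Equivalently, for every integer $n\ge 6$, there is a matrix in $\mathcal{S}(\overline{P_n})$ that is an orthogonal projection of rank three, and no matrix in $\mathcal{S}(\overline{P_n})$ is an orthogonal projection of rank one or two.
   Context: $P_n$ is the path on vertices $1,\dots,n$ with edges $\{i,i+1\}$ for $1\le i<n$, and $\overline{P_n}$ is its complement. For a simple graph $G$ on vertices $1,\dots,n$, $\mathcal{S}(G)$ is the set of real symmetric $n\times n$ matrices $A=[a_{ij}]$ such that for all $i\ne j$: $a_{ij}\ne 0$ if and only if $\{i,j\}\in E(G)$ (no restriction on the diagonal). A realization of $G$ is a matrix in $\mathcal{S}(G)$. $q(A)$ is the number of distinct eigenvalues of $A$, and $q(G)=\min\{q(A):A\in\mathcal{S}(G)\}$. When $q(G)=2$: for an integer $k$ with $1\le k\le\lfloor n/2\rfloor$, the bipartition $[n-k,k]$ is called achievable by $G$ if some $A\in\mathcal{S}(G)$ has exactly two distinct eigenvalues, with multiplicities $n-k$ and $k$. Then $MB(G)=\min\{k:[n-k,k]\text{ is achievable by }G\}$; $MB(G)$ is defined only when $q(G)=2$, so the claim $MB(\overline{P_n})=3$ includes $q(\overline{P_n})=2$. An orthogonal projection is a real symmetric matrix $P$ with $P^2=P$. *)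

theory Defs
  imports "Jordan_Normal_Form.Spectral_Radius" "Jordan_Normal_Form.DL_Rank"
begin

text \<open>
  A simple graph on the vertices 1, ..., n is given by the number \<open>n\<close> and its set \<open>E\<close> of edges,
  which are two-element subsets of \<open>{1..n}\<close>.
\<close>

definition path_edges :: "nat \<Rightarrow> nat set set" where
  "path_edges n = {{i, i + 1} |i. 1 \<le> i \<and> i < n}"

definition compl_edges :: "nat \<Rightarrow> nat set set \<Rightarrow> nat set set" where
  "compl_edges n E = {{i, j} |i j. i \<in> {1..n} \<and> j \<in> {1..n} \<and> i \<noteq> j} - E"

text \<open>Matrix indices start at 0, so vertex \<open>i\<close> corresponds to row and column \<open>i - 1\<close>.\<close>

definition realizations :: "nat \<Rightarrow> nat set set \<Rightarrow> real mat set" where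
  "realizations n E =
     {A \<in> carrier_mat n n. transpose_mat A = A \<and>
        (\<forall>i\<in>{1..n}. \<forall>j\<in>{1..n}. i \<noteq> j \<longrightarrow> (A $$ (i - 1, j - 1) \<noteq> 0 \<longleftrightarrow> {i, j} \<in> E))}"

text \<open>The eigenvalues of a real symmetric matrix are real, so the real spectrum is all of it.\<close>

definition q_mat :: "real mat \<Rightarrow> nat" where
  "q_mat A = card (spectrum A)"

definition q_graph :: "nat \<Rightarrow> nat set set \<Rightarrow> nat" where
  "q_graph n E = (LEAST m. \<exists>A \<in> realizations n E. q_mat A = m)"

text \<open>
  The multiplicity of an eigenvalue is its order as a root of the characteristic polynomial; for
  symmetric matrices this is also the geometric multiplicity.
\<close>

definition achievable :: "nat \<Rightarrow> nat set set \<Rightarrow> nat \<Rightarrow> bool" where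
  "achievable n E k \<longleftrightarrow> 1 \<le> k \<and> k \<le> n div 2 \<and>
     (\<exists>A \<in> realizations n E. \<exists>a b. a \<noteq> b \<and> spectrum A = {a, b} \<and>
        Polynomial.order a (char_poly A) = n - k \<and> Polynomial.order b (char_poly A) = k)"

text \<open>
  \<open>MB n E\<close> is meaningful only if \<open>q_graph n E = 2\<close>: then some \<open>k\<close> is achievable, so that
  \<open>LEAST\<close> is a genuine minimum.
\<close>

definition MB :: "nat \<Rightarrow> nat set set \<Rightarrow> nat" where
  "MB n E = (LEAST k. achievable n E k)"

definition orthogonal_projection :: "nat \<Rightarrow> real mat \<Rightarrow> bool" where
  "orthogonal_projection n P \<longleftrightarrow> P \<in> carrier_mat n n \<and> transpose_mat P = P \<and> P * P = P"

end

(*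
  A projection of rank 3 in S(G), G the complement of the path, is U U^T where the rows u_i of U in R^3
  form a Parseval frame in which exactly the consecutive vectors are orthogonal. Six vectors of this
  kind are given explicitly, with positive weights w_k such that the sum of w_k u_k u_k^T is the
  identity. Further vectors are added one at a time, generically in the plane orthogonal to the last
  one. If they get a small weight, changing the weights of the first six slightly restores the
  identity, because the six matrices u_k u_k^T span the symmetric matrices.

  Conversely, in a projection with this zero pattern the 3 by 3 minor with rows 1, 2, 3 and columns
  2, 3, 4 is a product of nonzero entries, so the rank is at least 3. A symmetric matrix with two
  eigenvalues is an affine image of a projection whose rank is the multiplicity of one of them.
*)
theory Submission
  imports Defs
    "Jordan_Normal_Form.DL_Rank_Submatrix"
    "Jordan_Normal_Form.Jordan_Normal_Form_Uniqueness"
begin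

section \<open>Frames in three-dimensional space\<close>

text \<open>A vector of R^3 is a function on \<open>nat\<close> of which only the values at 0, 1, 2
  matter. Below, \<open>vprod\<close> is the cross product and \<open>det3\<close> the scalar triple
  product.\<close>

definition dot3 :: "(nat \<Rightarrow> real) \<Rightarrow> (nat \<Rightarrow> real) \<Rightarrow> real" where
  "dot3 u v = u 0 * v 0 + u 1 * v 1 + u 2 * v 2"

definition vprod :: "(nat \<Rightarrow> real) \<Rightarrow> (nat \<Rightarrow> real) \<Rightarrow> nat \<Rightarrow> real" where
  "vprod u v = (!) [u 1 * v 2 - u 2 * v 1, u 2 * v 0 - u 0 * v 2, u 0 * v 1 - u 1 * v 0]"

definition det3 :: "(nat \<Rightarrow> real) \<Rightarrow> (nat \<Rightarrow> real) \<Rightarrow> (nat \<Rightarrow> real) \<Rightarrow> real" where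
  "det3 u v w = dot3 u (vprod v w)"

lemmas vec3_defs = det3_def dot3_def vprod_def numeral_2_eq_2

lemma dot3_commute: "dot3 u v = dot3 v u"
  by (simp add: dot3_def)

text \<open>As b is orthogonal to c, the plane orthogonal to c is spanned by b and p = c x b, and w
  is sought on the line b + t p. Each s in S excludes at most one t. The vector a is orthogonal to
  b, so its product with w is t (a . p), where a . p is minus the given determinant: t must not be
  0. The new determinant is -t (p . p), so the construction can be repeated.\<close>

lemma exists_generic_orthogonal:
  assumes det: "det3 a b c \<noteq> 0" and ab: "dot3 a b = 0" and bc: "dot3 b c = 0"
    and fin: "finite S" and S: "\<And>s. s \<in> S \<Longrightarrow> dot3 s b \<noteq> 0"
  obtains w where "dot3 c w = 0" "dot3 a w \<noteq> 0" "dot3 b w \<noteq> 0" "det3 b c w \<noteq> 0"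
    "\<And>s. s \<in> S \<Longrightarrow> dot3 s w \<noteq> 0"
proof -
  define p where "p = vprod c b"
  \<comment> \<open>If \<open>dot3 s p\<close> is 0, no t is bad for s; the quotient is then 0 by
    convention, a value that is excluded anyway.\<close>
  define bad where "bad = insert 0 ((\<lambda>s. - dot3 s b / dot3 s p) ` S)"
  have "finite bad"
    using fin by (simp add: bad_def)
  then obtain t where t: "t \<notin> bad"
    using ex_new_if_finite infinite_UNIV_char_0 by blast
  define w where "w = (\<lambda>r. b r + t * p r)"
  have dot_w: "dot3 s w = dot3 s b + t * dot3 s p" for s
    by (simp add: w_def dot3_def algebra_simps)
  have "dot3 c p = 0" "dot3 b p = 0" "dot3 a p = - det3 a b c"
    by (simp_all add: p_def vec3_defs algebra_simps)
  have "b 0 \<noteq> 0 \<or> b 1 \<noteq> 0 \<or> b 2 \<noteq> 0"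
    using det by (auto simp: vec3_defs)
  then have "dot3 b b > 0"
    unfolding dot3_def by (metis add_pos_nonneg add_nonneg_pos add_nonneg_nonneg not_real_square_gt_zero zero_le_square)
  have "p 0 \<noteq> 0 \<or> p 1 \<noteq> 0 \<or> p 2 \<noteq> 0"
    using \<open>dot3 a p = - det3 a b c\<close> det by (auto simp: dot3_def)
  then have pp: "dot3 p p > 0"
    unfolding dot3_def by (metis add_pos_nonneg add_nonneg_pos add_nonneg_nonneg not_real_square_gt_zero zero_le_square)
  have t0: "t \<noteq> 0"
    using t by (simp add: bad_def)
  have "det3 b c w = - t * dot3 p p"
    by (simp add: w_def p_def vec3_defs algebra_simps)
  moreover have "dot3 s w \<noteq> 0" if "s \<in> S" for s
  proof
    assume "dot3 s w = 0"
    then have "t * dot3 s p = - dot3 s b"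
      by (simp add: dot_w)
    then have "t = - dot3 s b / dot3 s p"
      using S[OF that] by (cases "dot3 s p = 0") (auto simp: field_simps)
    then show False
      using t that by (auto simp: bad_def)
  qed
  moreover have "dot3 c w = 0"
    using \<open>dot3 c p = 0\<close> bc by (simp add: dot_w dot3_commute)
  moreover have "dot3 a w \<noteq> 0"
    using \<open>dot3 a p = - det3 a b c\<close> det ab t0 by (simp add: dot_w)
  moreover have "dot3 b w \<noteq> 0"
    using \<open>dot3 b p = 0\<close> \<open>dot3 b b > 0\<close> by (simp add: dot_w)
  ultimately show thesis
    using that pp t0 by auto
qed

section \<open>Vector sequences whose orthogonality graph is the path\<close>

definition path_orthogonal :: "nat \<Rightarrow> (nat \<Rightarrow> nat \<Rightarrow> real) \<Rightarrow> bool" where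
  "path_orthogonal n v \<longleftrightarrow>
     (\<forall>j < n. \<forall>i < j. dot3 (v i) (v j) = 0 \<longleftrightarrow> j = Suc i)"

text \<open>Six vectors with the prescribed orthogonality pattern, found by computer search, whose
  squares are a basis of the symmetric 3 by 3 matrices and have the identity matrix in the interior
  of their cone.\<close>

definition seed :: "nat \<Rightarrow> nat \<Rightarrow> real" where
  "seed k r = [[0, 1, -1], [1, 0, 0], [0, 0, 1], [2, -1, 0], [1, 2, 1], [1, 0, -1]] ! k ! r"

lemma less_6_cases: "(i::nat) < 6 \<longleftrightarrow> i = 0 \<or> i = 1 \<or> i = 2 \<or> i = 3 \<or> i = 4 \<or> i = 5"
  by auto

lemma sum_less_6: "(\<Sum>k<6. f k) = f 0 + f 1 + f 2 + f 3 + f 4 + f 5"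
  for f :: "nat \<Rightarrow> real"
  by (simp add: eval_nat_numeral)

lemma seed_values:
  "seed 0 0 = 0" "seed 0 1 = 1" "seed 0 2 = -1"
  "seed 1 0 = 1" "seed 1 1 = 0" "seed 1 2 = 0"
  "seed 2 0 = 0" "seed 2 1 = 0" "seed 2 2 = 1"
  "seed 3 0 = 2" "seed 3 1 = -1" "seed 3 2 = 0"
  "seed 4 0 = 1" "seed 4 1 = 2" "seed 4 2 = 1"
  "seed 5 0 = 1" "seed 5 1 = 0" "seed 5 2 = -1"
  by (simp_all add: seed_def)

lemma path_orthogonal_seed: "path_orthogonal 6 seed"
  unfolding path_orthogonal_def
proof (intro allI impI)
  fix i j :: nat
  assume "j < 6" and ij: "i < j"
  then have "i < 6"
    by simp
  with \<open>j < 6\<close> ij show "(dot3 (seed i) (seed j) = 0) = (j = Suc i)"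
    unfolding less_6_cases by (elim disjE; simp add: dot3_def seed_values[simplified])
qed

lemma seed_spans:
  assumes sym: "\<And>r s. S r s = S s r"
  obtains c where "\<And>r s. r < 3 \<Longrightarrow> s < 3 \<Longrightarrow> (\<Sum>k<6. c k * (seed k r * seed k s)) = S r s"
proof -
  \<comment> \<open>Obtained by inverting the 6 by 6 system for the entries on and above the diagonal.\<close>
  define c :: "nat \<Rightarrow> real" where "c = (!)
    [(S 0 1 + 2 * S 1 1 - 5 * S 1 2) / 7,
     S 0 0 + 11/7 * S 0 1 + S 0 2 - 6/7 * S 1 1 - 6/7 * S 1 2,
     - 2/7 * S 0 1 + S 0 2 - 4/7 * S 1 1 + 3/7 * S 1 2 + S 2 2,
     (- 3 * S 0 1 + S 1 1 + S 1 2) / 7,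
     (S 0 1 + 2 * S 1 1 + 2 * S 1 2) / 14,
     (S 0 1 - 14 * S 0 2 + 2 * S 1 1 + 2 * S 1 2) / 14]"
  have "(\<Sum>k<6. c k * (seed k r * seed k s)) = S r s" if "r < 3" "s < 3" for r s
  proof -
    have "r = 0 \<or> r = 1 \<or> r = 2" "s = 0 \<or> s = 1 \<or> s = 2"
      using that by auto
    then show ?thesis
      using sym[of 1 0] sym[of 2 0] sym[of 2 1]
      by (elim disjE; simp add: sum_less_6 c_def seed_values[simplified] field_simps)
  qed
  then show thesis
    using that by blast
qed

text \<open>Induction on n, appending one vector each time. Independence of the last three vectors
  is carried along because the extension step requires it and restores it.\<close>

lemma exists_path_orthogonal:
  assumes "n \<ge> 6"
  shows "\<exists>v. path_orthogonal n v \<and> (\<forall>k<6. v k = seed k) \<and> det3 (v (n - 3)) (v (n - 2)) (v (n - 1)) \<noteq> 0"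
  using assms
proof (induction n rule: nat_induct_at_least)
  case base
  have "det3 (seed 3) (seed 4) (seed 5) \<noteq> 0"
    using seed_values by (simp add: vec3_defs)
  then show ?case
    using path_orthogonal_seed by auto
next
  case (Suc n)
  then obtain v where v: "path_orthogonal n v" and vb: "\<forall>k<6. v k = seed k"
    and det: "det3 (v (n - 3)) (v (n - 2)) (v (n - 1)) \<noteq> 0"
    by auto
  have n: "n \<ge> 6" by fact
  have dot: "dot3 (v i) (v j) = 0 \<longleftrightarrow> j = Suc i" if "i < j" "j < n" for i j
    using v that by (simp add: path_orthogonal_def)
  \<comment> \<open>The vectors v 0, ..., v (n - 4) are not neighbours of v (n - 2), so they may
    form the set S. Its neighbours v (n - 3) and v (n - 1) play a and c.\<close>
  obtain w where w: "dot3 (v (n - 1)) w = 0" "dot3 (v (n - 3)) w \<noteq> 0" "dot3 (v (n - 2)) w \<noteq> 0"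
      "det3 (v (n - 2)) (v (n - 1)) w \<noteq> 0" "\<And>s. s \<in> v ` {..<n - 3} \<Longrightarrow> dot3 s w \<noteq> 0"
  proof (rule exists_generic_orthogonal[OF det, of "v ` {..<n - 3}"])
    show "dot3 s (v (n - 2)) \<noteq> 0" if "s \<in> v ` {..<n - 3}" for s
      using that n dot by auto
  qed (use n dot in auto)
  define v' where "v' = v(n := w)"
  have w_dot: "dot3 (v i) w = 0 \<longleftrightarrow> n = Suc i" if "i < n" for i
  proof -
    have "i < n - 3 \<or> i = n - 3 \<or> i = n - 2 \<or> i = n - 1"
      using that by arith
    then show ?thesis
      using w n by auto
  qed
  have "path_orthogonal (Suc n) v'"
    using dot w_dot by (auto simp: path_orthogonal_def v'_def less_Suc_eq)
  moreover have "\<forall>k<6. v' k = seed k"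
    using vb n by (simp add: v'_def)
  moreover have "det3 (v' (Suc n - 3)) (v' (Suc n - 2)) (v' (Suc n - 1)) \<noteq> 0"
    using w(4) n by (simp add: v'_def Suc_diff_le numeral_2_eq_2 numeral_3_eq_3)
  ultimately show ?case
    by blast
qed

section \<open>Weights that turn the sequence into a Parseval frame\<close>

text \<open>These are the coefficients of \<open>seed_spans\<close> for S the identity matrix. All
  are at least 1/7, which leaves room for a perturbation.\<close>

definition seed_weight :: "nat \<Rightarrow> real" where
  "seed_weight k = [2/7, 1/7, 3/7, 1/7, 1/7, 1/7] ! k"

lemma seed_tight:
  assumes "r < 3" "s < 3"
  shows "(\<Sum>k<6. seed_weight k * (seed k r * seed k s)) = (if r = s then 1 else 0)"
proof -
  have "r = 0 \<or> r = 1 \<or> r = 2" "s = 0 \<or> s = 1 \<or> s = 2"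
    using assms by auto
  then show ?thesis
    by (elim disjE; simp add: sum_less_6 seed_weight_def seed_values[simplified])
qed

text \<open>Scaling vectors by nonzero factors preserves orthogonality, so it suffices to find
  positive weights W i for which the weighted sum of the squares of the v i is the identity; then u
  i is v i scaled by the root of W i.\<close>

lemma exists_tight_frame:
  assumes n: "n \<ge> 6"
  obtains u where "path_orthogonal n u"
    "\<And>r s. r < 3 \<Longrightarrow> s < 3 \<Longrightarrow> (\<Sum>i<n. u i r * u i s) = (if r = s then 1 else 0)"
proof -
  obtain v where v: "path_orthogonal n v" and vb: "\<forall>k<6. v k = seed k"
    using exists_path_orthogonal[OF n] by blast
  \<comment> \<open>Give all vectors beyond the sixth the small weight e and compensate with the first six.\<close>
  define S where "S r s = (\<Sum>i\<in>{6..<n}. v i r * v i s)" for r s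
  have "S r s = S s r" for r s
    by (simp add: S_def mult.commute)
  then obtain c where c: "\<And>r s. r < 3 \<Longrightarrow> s < 3 \<Longrightarrow> (\<Sum>k<6. c k * (seed k r * seed k s)) = S r s"
    using seed_spans by blast
  \<comment> \<open>Chosen so that e * c k stays strictly below 1/7, the least seed weight. The
    summand 1 gives strictness and keeps the denominator positive if all c k vanish.\<close>
  define e where "e = 1 / (7 * (1 + (\<Sum>k<6. \<bar>c k\<bar>)))"
  have pos: "1 + (\<Sum>k<6. \<bar>c k\<bar>) > 0"
    by (smt (verit) sum_nonneg abs_ge_zero)
  then have e: "e > 0"
    by (simp add: e_def)
  have ec: "e * c k < seed_weight k" if "k < 6" for k
  proof -
    have "c k \<le> (\<Sum>k<6. \<bar>c k\<bar>)"
      using that member_le_sum[of k "{..<6}" "\<lambda>k. \<bar>c k\<bar>"] by simp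
    then have "e * c k < e * (1 + (\<Sum>k<6. \<bar>c k\<bar>))"
      using e by (intro mult_strict_left_mono) auto
    also have "\<dots> = 1 / 7"
      using pos by (simp add: e_def field_simps)
    also have "\<dots> \<le> seed_weight k"
      using that by (auto simp: less_6_cases seed_weight_def)
    finally show ?thesis .
  qed
  \<comment> \<open>The correction - e * c i on the seeds cancels e * S, the contribution of the
    later vectors.\<close>
  define W where "W i = (if i < 6 then seed_weight i - e * c i else e)" for i
  have W: "W i > 0" for i
    using e ec by (simp add: W_def)
  define u where "u i r = sqrt (W i) * v i r" for i r
  have "dot3 (u i) (u j) = sqrt (W i) * sqrt (W j) * dot3 (v i) (v j)" for i j
    by (simp add: u_def dot3_def algebra_simps)
  then have "path_orthogonal n u"
    using v by (simp add: path_orthogonal_def W[THEN less_imp_neq, symmetric])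
  moreover have "(\<Sum>i<n. u i r * u i s) = (if r = s then 1 else 0)" if "r < 3" "s < 3" for r s
  proof -
    have "u i r * u i s = W i * (v i r * v i s)" for i
      using W[of i] by (simp add: u_def algebra_simps flip: mult.assoc[of "sqrt _" "sqrt _"])
    then have "(\<Sum>i<n. u i r * u i s) = (\<Sum>i<n. W i * (v i r * v i s))"
      by simp
    also have "\<dots> = (\<Sum>i<6. W i * (v i r * v i s)) + (\<Sum>i\<in>{6..<n}. W i * (v i r * v i s))"
      using n sum.atLeastLessThan_concat[of 0 6 n "\<lambda>i. W i * (v i r * v i s)"] by (simp add: atLeast0LessThan)
    also have "(\<Sum>i\<in>{6..<n}. W i * (v i r * v i s)) = e * S r s"
      by (simp add: W_def S_def sum_distrib_left)
    also have "(\<Sum>i<6. W i * (v i r * v i s))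
        = (\<Sum>k<6. seed_weight k * (seed k r * seed k s)) - e * (\<Sum>k<6. c k * (seed k r * seed k s))"
      unfolding sum_distrib_left sum_subtractf[symmetric]
      by (intro sum.cong) (use vb in \<open>auto simp: W_def algebra_simps\<close>)
    also have "\<dots> = (if r = s then 1 else 0) - e * S r s"
      using that by (simp add: seed_tight c)
    finally show ?thesis
      by simp
  qed
  ultimately show thesis
    using that by blast
qed

section \<open>Rank and diagonalization\<close>

context vec_space
begin

text \<open>Subadditivity of the rank. It bounds the rank of a Gram matrix by the dimension of the
  vectors, and that of a spectral projection by the multiplicity of the eigenvalue.\<close>

lemma rank_le_card_rank_one_summands:
  assumes "finite J" "A \<in> carrier_mat n nc"
    and "\<And>r c. r < n \<Longrightarrow> c < nc \<Longrightarrow> A $$ (r, c) = (\<Sum>j\<in>J. f j r * g j c)"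
  shows "rank A \<le> card J"
  using assms
proof (induction J arbitrary: A rule: finite_induct)
  case empty
  then have "A = 0\<^sub>m n nc"
    by (intro eq_matI) auto
  then show ?case
    by (simp add: rank_0I)
next
  case (insert j J)
  define B where "B = mat n nc (\<lambda>(r, c). f j r * g j c)"
  define C where "C = mat n nc (\<lambda>(r, c). \<Sum>j\<in>J. f j r * g j c)"
  have B: "B \<in> carrier_mat n nc" and C: "C \<in> carrier_mat n nc"
    by (simp_all add: B_def C_def)
  have "A = B + C"
    using insert by (intro eq_matI) (auto simp: B_def C_def)
  moreover have "rank B \<le> 1"
    by (rule rank_le_1_product_entries[OF B, of "f j" "g j"]) (simp add: B_def)
  moreover have "rank C \<le> card J"
    using insert by (intro insert.IH[OF C]) (simp add: C_def)
  ultimately show ?case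
    using rank_subadditive[OF B C] insert by simp
qed

end

section \<open>A nonzero minor of order three\<close>

lemma card_less_3_Int: "card {i::nat. i < n \<and> i \<in> {a, b, c}} = 3"
  if "a < b" "b < c" "c < n"
proof -
  have "{i. i < n \<and> i \<in> {a, b, c}} = {a, b, c}"
    using that by auto
  then show ?thesis
    using that by simp
qed

text \<open>Translates indices of a submatrix into indices of the full matrix: an element of a set
  is picked at the position given by the number of smaller elements.\<close>

lemma pick_triple:
  assumes "a < b" "b < (c::nat)"
  shows "pick {a, b, c} 0 = a" "pick {a, b, c} 1 = b" "pick {a, b, c} 2 = c"
proof -
  have "{x \<in> {a, b, c}. x < a} = {}" "{x \<in> {a, b, c}. x < b} = {a}" "{x \<in> {a, b, c}. x < c} = {a, b}"
    using assms by auto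
  then have "card {x \<in> {a, b, c}. x < a} = 0" "card {x \<in> {a, b, c}. x < b} = 1"
      "card {x \<in> {a, b, c}. x < c} = 2"
    using assms by simp_all
  then show "pick {a, b, c} 0 = a" "pick {a, b, c} 1 = b" "pick {a, b, c} 2 = c"
    using pick_card_in_set[of a "{a, b, c}"] pick_card_in_set[of b "{a, b, c}"]
      pick_card_in_set[of c "{a, b, c}"] by (simp_all only: insert_iff simp_thms)
qed

lemma det_2:
  assumes "(A :: 'a :: comm_ring_1 mat) \<in> carrier_mat 2 2"
  shows "det A = A $$ (0,0) * A $$ (1,1) - A $$ (1,0) * A $$ (0,1)"
proof -
  have cof: "cofactor A i 0 = (- 1) ^ i * mat_delete A i 0 $$ (0,0)" if "i < 2" for i
    unfolding cofactor_def by (subst det_single) (use assms that in \<open>auto simp: mat_delete_def\<close>)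
  have "det A = (\<Sum>i<2. A $$ (i,0) * cofactor A i 0)"
    using laplace_expansion_column[OF assms, of 0] by simp
  then show ?thesis
    using assms by (simp add: cof mat_delete_def numeral_2_eq_2)
qed

lemma det_3:
  assumes "(A :: 'a :: comm_ring_1 mat) \<in> carrier_mat 3 3"
  shows "det A = A $$ (0,0) * (A $$ (1,1) * A $$ (2,2) - A $$ (1,2) * A $$ (2,1))
     - A $$ (1,0) * (A $$ (0,1) * A $$ (2,2) - A $$ (0,2) * A $$ (2,1))
     + A $$ (2,0) * (A $$ (0,1) * A $$ (1,2) - A $$ (0,2) * A $$ (1,1))"
proof -
  have cof: "cofactor A i 0 = (- 1) ^ i * (mat_delete A i 0 $$ (0,0) * mat_delete A i 0 $$ (1,1)
      - mat_delete A i 0 $$ (0,1) * mat_delete A i 0 $$ (1,0))" if "i < 3" for i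
    unfolding cofactor_def by (subst det_2) (use assms that in \<open>auto simp: mat_delete_def mult.commute\<close>)
  have "det A = (\<Sum>i<3. A $$ (i,0) * cofactor A i 0)"
    using laplace_expansion_column[OF assms, of 0] by simp
  also have "\<dots> = A $$ (0,0) * cofactor A 0 0 + A $$ (1,0) * cofactor A 1 0 + A $$ (2,0) * cofactor A 2 0"
    by (simp add: eval_nat_numeral)
  finally show ?thesis
    using assms by (simp add: cof mat_delete_def numeral_2_eq_2 algebra_simps)
qed

lemma transpose_mat_index:
  assumes "transpose_mat A = A" "A \<in> carrier_mat n n" "i < n" "j < n"
  shows "A $$ (i, j) = A $$ (j, i)"
  using assms by (metis carrier_matD index_transpose_mat(1))

text \<open>The submatrix with rows 0, 1, 2 and columns 1, 2, 3 has only one nonzero term in its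
  determinant.\<close>

lemma rank_ge_3_of_path_zeros:
  fixes A :: "real mat"
  assumes A: "A \<in> carrier_mat n n" and n: "n \<ge> 4"
    and zero: "A $$ (0,1) = 0" "A $$ (1,2) = 0" "A $$ (2,1) = 0" "A $$ (2,3) = 0"
    and nz: "A $$ (0,3) \<noteq> 0" "A $$ (1,1) \<noteq> 0" "A $$ (2,2) \<noteq> 0"
  shows "vec_space.rank n A \<ge> 3"
proof -
  let ?M = "submatrix A {0, 1, 2} {1, 2, 3}"
  have card: "card {i. i < dim_row A \<and> i \<in> {0, 1, 2}} = 3" "card {i. i < dim_col A \<and> i \<in> {1, 2, 3}} = 3"
    using n A by (intro card_less_3_Int; simp)+
  then have M: "?M \<in> carrier_mat 3 3"
    by (intro carrier_matI) (simp_all only: dim_submatrix)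
  have ix: "?M $$ (i, j) = A $$ (pick {0, 1, 2} i, pick {1, 2, 3} j)" if "i < 3" "j < 3" for i j
    using that by (intro submatrix_index) (simp_all only: card)
  define M where "M = ?M"
  have p: "pick {0, 1, 2} 0 = 0" "pick {0, 1, 2} 1 = 1" "pick {0, 1, 2} 2 = 2"
    "pick {1, 2, 3} 0 = 1" "pick {1, 2, 3} 1 = 2" "pick {1, 2, 3} 2 = 3"
    using pick_triple[of 0 1 2] pick_triple[of 1 2 3] by auto
  have "M $$ (0,0) = 0" "M $$ (0,1) = A $$ (0,2)" "M $$ (0,2) = A $$ (0,3)"
    "M $$ (1,0) = A $$ (1,1)" "M $$ (1,1) = 0" "M $$ (1,2) = A $$ (1,3)"
    "M $$ (2,0) = 0" "M $$ (2,1) = A $$ (2,2)" "M $$ (2,2) = 0"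
    unfolding M_def using ix[of 0 0] ix[of 0 1] ix[of 0 2] ix[of 1 0] ix[of 1 1] ix[of 1 2]
      ix[of 2 0] ix[of 2 1] ix[of 2 2] by (simp_all only: p zero)
  then have "det ?M = A $$ (1,1) * (A $$ (0,3) * A $$ (2,2))"
    using det_3[OF M[folded M_def]] by (simp add: M_def)
  then have "det ?M \<noteq> 0"
    using nz by simp
  then have "card {j. j < n \<and> j \<in> {1, 2, 3}} \<le> vec_space.rank n A"
    by (rule vec_space.rank_gt_minor[OF A])
  then show ?thesis
    using card A by simp
qed

section \<open>Diagonalization of real symmetric matrices\<close>

text \<open>Moving the matrix from one side of the Hermitian product of v with itself to the other
  turns the factor l into its conjugate, and that product is nonzero.\<close>

lemma symmetric_eigenvalue_real:
  assumes A: "A \<in> carrier_mat n n" and sym: "transpose_mat A = A"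
    and ev: "eigenvalue (map_mat complex_of_real A) l"
  shows "l \<in> \<real>"
proof -
  let ?C = "map_mat complex_of_real A"
  obtain v where v: "v \<in> carrier_vec n" "v \<noteq> 0\<^sub>v n" and Cv: "?C *\<^sub>v v = l \<cdot>\<^sub>v v"
    using ev A by (auto simp: eigenvalue_def eigenvector_def)
  have C: "?C \<in> carrier_mat n n" using A by simp
  have symC: "transpose_mat ?C = ?C"
    using sym A by (metis map_mat_transpose)
  have cv: "conjugate v \<in> carrier_vec n" using v by simp
  have "?C *\<^sub>v conjugate v = conjugate (?C *\<^sub>v v)"
  proof (rule eq_vecI)
    fix i
    assume "i < dim_vec (conjugate (?C *\<^sub>v v))"
    then have i: "i < n"
      using A by simp
    then show "(?C *\<^sub>v conjugate v) $ i = conjugate (?C *\<^sub>v v) $ i"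
      using A v by (simp add: scalar_prod_def)
  qed (use A in simp)
  also have "\<dots> = cnj l \<cdot>\<^sub>v conjugate v"
    using v by (intro eq_vecI) (simp_all add: Cv)
  finally have Ccv: "?C *\<^sub>v conjugate v = cnj l \<cdot>\<^sub>v conjugate v" .
  have "l * (v \<bullet>c v) = (?C *\<^sub>v v) \<bullet>c v"
    using v by (simp add: Cv)
  also have "\<dots> = v \<bullet> (?C *\<^sub>v conjugate v)"
    using transpose_vec_mult_scalar[OF C cv v(1)] symC by simp
  also have "\<dots> = cnj l * (v \<bullet>c v)"
    using v by (simp add: Ccv)
  finally have "l = cnj l"
    using v by (simp add: conjugate_square_eq_0_vec)
  then show ?thesis
    by (metis Reals_cnj_iff)
qed

text \<open>Factor over the complex numbers, note that all roots are real, and pull the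
  factorization back along the injective embedding. A real Jordan form exists only after
  this.\<close>

lemma symmetric_char_poly_splits:
  assumes A: "A \<in> carrier_mat n n" and sym: "transpose_mat (A :: real mat) = A"
  obtains rs where "char_poly A = (\<Prod>r\<leftarrow>rs. [:- r, 1:])"
proof -
  interpret map_poly_inj_idom_hom complex_of_real ..
  let ?C = "map_mat complex_of_real A"
  have C: "?C \<in> carrier_mat n n" using A by simp
  obtain zs where zs: "char_poly ?C = (\<Prod>z\<leftarrow>zs. [:- z, 1:])"
    using char_poly_factorized[OF C] by auto
  have "z \<in> \<real>" if "z \<in> set zs" for z
  proof (rule symmetric_eigenvalue_real[OF A sym])
    have "poly (char_poly ?C) z = 0"
      using that unfolding zs by (simp add: poly_prod_list o_def prod_list_zero_iff image_iff)
    then show "eigenvalue ?C z"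
      by (simp add: eigenvalue_root_char_poly[OF C])
  qed
  then have "zs = map of_real (map Re zs)"
    by (induction zs) auto
  define rs where "rs = map Re zs"
  have "map_poly complex_of_real (char_poly A) = char_poly ?C"
    by (rule of_real_hom.char_poly_hom[OF A, symmetric])
  also have "\<dots> = (\<Prod>r\<leftarrow>rs. [:- of_real r, 1:])"
    unfolding zs by (subst \<open>zs = _\<close>) (simp add: rs_def o_def)
  also have "\<dots> = map_poly of_real (\<Prod>r\<leftarrow>rs. [:- r, 1:])"
    by (simp add: hom_prod_list o_def del: prod_list_map_hom)
  finally have "char_poly A = (\<Prod>r\<leftarrow>rs. [:- r, 1:])"
    by simp
  then show thesis
    by (rule that)
qed

text \<open>If C C x = 0, then (C x) . (C x) = x . (C C x) = 0. Applied to A - e I, this excludes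
  generalized eigenvectors of order two.\<close>

lemma mat_kernel_symmetric_square:
  assumes C: "C \<in> carrier_mat n n" and sym: "transpose_mat (C :: real mat) = C"
  shows "mat_kernel (C * C) = mat_kernel C"
proof
  show "mat_kernel C \<subseteq> mat_kernel (C * C)"
    by (rule mat_kernel_mult_subset[OF C C])
  show "mat_kernel (C * C) \<subseteq> mat_kernel C"
  proof
    fix x
    assume "x \<in> mat_kernel (C * C)"
    then have x: "x \<in> carrier_vec n" and "C *\<^sub>v (C *\<^sub>v x) = 0\<^sub>v n"
      using C mat_kernelD[of "C * C" n n x] by (auto simp: assoc_mult_mat_vec)
    then have "(C *\<^sub>v x) \<bullet> (C *\<^sub>v x) = 0"
      using transpose_vec_mult_scalar[OF C x, of "C *\<^sub>v x"] C sym by simp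
    then have "C *\<^sub>v x = 0\<^sub>v n"
      using conjugate_square_eq_0_vec[of "C *\<^sub>v x" n] C x by simp
    then show "x \<in> mat_kernel C"
      using C x by (intro mat_kernelI)
  qed
qed

lemma jordan_matrix_size_1:
  assumes "\<forall>na\<in>set n_as. fst na = 1"
  shows "jordan_matrix n_as = mat_diag (length n_as) (\<lambda>i. snd (n_as ! i))"
  using assms
proof (induction n_as)
  case Nil
  then show ?case
    by (intro eq_matI) (auto simp: mat_diag_def)
next
  case (Cons na n_as)
  have sum: "sum_list (map fst n_as) = length n_as"
    using Cons.prems by (induction n_as) auto
  obtain a where na: "na = (1, a)"
    using Cons.prems by (cases na) auto
  have "jordan_matrix n_as = mat_diag (length n_as) (\<lambda>i. snd (n_as ! i))"
    using Cons by simp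
  then show ?case
    unfolding na jordan_matrix_Cons sum
    by (intro eq_matI) (auto simp: mat_diag_def nth_Cons')
qed

text \<open>For the sizes of the Jordan blocks of one eigenvalue e, the two sums are the dimensions
  of the kernels of A - e I and of its square. Termwise comparison shows that equality forces every
  block to have size at most 1.\<close>

lemma sum_list_min_eq_imp_le_1:
  fixes ms :: "nat list"
  assumes "(\<Sum>m\<leftarrow>ms. min 1 m) = (\<Sum>m\<leftarrow>ms. min 2 m)" "m \<in> set ms"
  shows "m \<le> 1"
  using assms
proof (induction ms)
  case (Cons k ms)
  have "(\<Sum>m\<leftarrow>ms. min 1 m) \<le> (\<Sum>m\<leftarrow>ms. min 2 m)"
    by (rule sum_list_mono) auto
  then have "(\<Sum>m\<leftarrow>ms. min 1 m) = (\<Sum>m\<leftarrow>ms. min 2 m)" "k \<le> 1"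
    using Cons.prems(1) by auto
  then show ?case
    using Cons by auto
qed simp

text \<open>The Jordan form has only blocks of size 1. An invertible P is enough, without
  orthogonality: multiplicities, rank and trace are similarity invariants, and symmetry of matrices
  derived from A is read off from A itself.\<close>

lemma symmetric_diagonalizable:
  assumes A: "A \<in> carrier_mat n n" and sym: "transpose_mat (A :: real mat) = A"
  obtains P Q d where "P \<in> carrier_mat n n" "Q \<in> carrier_mat n n" "P * Q = 1\<^sub>m n" "Q * P = 1\<^sub>m n"
    "A = P * mat_diag n d * Q" "\<forall>e. Polynomial.order e (char_poly A) = card {i. i < n \<and> d i = e}"
proof -
  obtain rs where "char_poly A = (\<Prod>r\<leftarrow>rs. [:- r, 1:])"
    using symmetric_char_poly_splits[OF A sym] .
  then obtain n_as where jnf: "jordan_nf A n_as"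
    using jordan_nf_exists[OF A] by blast
  then have sim: "similar_mat A (jordan_matrix n_as)" and nz: "0 \<notin> fst ` set n_as"
    by (simp_all add: jordan_nf_def)
  have le_1: "m \<le> 1" if "(m, e) \<in> set n_as" for m e
  proof (rule sum_list_min_eq_imp_le_1)
    let ?C = "char_matrix A e"
    have C: "?C \<in> carrier_mat n n"
      using A by simp
    have "transpose_mat ?C = ?C"
      using A transpose_mat_index[OF sym A] by (intro eq_matI) (auto simp: char_matrix_def)
    then have "kernel_dim (?C * ?C) = kernel_dim ?C"
      using mat_kernel_symmetric_square[OF C] C by (simp add: kernel_dim_def)
    then have "dim_gen_eigenspace A e 1 = dim_gen_eigenspace A e 2"
      using C by (simp add: dim_gen_eigenspace_def numeral_2_eq_2)
    then show "(\<Sum>m\<leftarrow>map fst [(m, b)\<leftarrow>n_as. b = e]. min 1 m) = (\<Sum>m\<leftarrow>map fst [(m, b)\<leftarrow>n_as. b = e]. min 2 m)"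
      by (simp add: dim_gen_eigenspace_similar[OF sim] dim_gen_eigenspace_jordan_matrix)
    show "m \<in> set (map fst [(m, b)\<leftarrow>n_as. b = e])"
      using that by force
  qed
  have size_1: "\<forall>na\<in>set n_as. fst na = 1"
  proof
    fix na
    assume na: "na \<in> set n_as"
    then have "fst na \<noteq> 0"
      using nz by force
    then show "fst na = 1"
      using le_1[of "fst na" "snd na"] na by simp
  qed
  define d where "d i = snd (n_as ! i)" for i
  have J: "jordan_matrix n_as = mat_diag (length n_as) d"
    unfolding d_def by (rule jordan_matrix_size_1[OF size_1])
  obtain P Q where "similar_mat_wit A (mat_diag (length n_as) d) P Q"
    using sim by (auto simp: J similar_mat_def)
  note wit = similar_mat_witD2[OF A this]
  have len: "length n_as = n"
    using wit(5) mat_diag_dim[of "length n_as" d] by (metis carrier_matD(1))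
  have "Polynomial.order e (char_poly A) = card {i. i < n \<and> d i = e}" for e
  proof -
    have "Polynomial.order e (char_poly A) = sum_list (map fst (filter (\<lambda>na. snd na = e) n_as))"
      by (rule jordan_nf_order[OF jnf])
    also have "\<dots> = length (filter (\<lambda>na. snd na = e) n_as)"
      using size_1 by (induction n_as) auto
    also have "\<dots> = card {i. i < n \<and> d i = e}"
      by (simp add: length_filter_conv_card len d_def)
    finally show ?thesis .
  qed
  then show thesis
    using that[OF wit(6,7,1,2) wit(3)[unfolded len]] by blast
qed

lemma spectrum_eq_diagonal:
  assumes A: "A \<in> carrier_mat n n" and ord: "\<forall>e. Polynomial.order e (char_poly A) = card {i. i < n \<and> d i = (e::real)}"
  shows "spectrum A = d ` {..<n}"
proof -
  have "char_poly A \<noteq> 0"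
    using degree_monic_char_poly[OF A] by auto
  then have "e \<in> spectrum A \<longleftrightarrow> card {i. i < n \<and> d i = e} \<noteq> 0" for e
    by (simp add: spectrum_def eigenvalue_root_char_poly[OF A] order_root ord)
  then show ?thesis
    by auto
qed

lemma conj_mat_diag_index:
  assumes P: "P \<in> carrier_mat n n" and Q: "Q \<in> carrier_mat n n" and "r < n" "c < n"
  shows "(P * mat_diag n d * Q) $$ (r, c) = (\<Sum>i<n. P $$ (r, i) * (d i :: real) * Q $$ (i, c))"
  using assms by (simp add: mat_diag_mult_right[OF P] scalar_prod_def atLeast0LessThan)

lemma conj_mat_diag_const:
  assumes P: "P \<in> carrier_mat n n" and Q: "Q \<in> carrier_mat n n" and PQ: "P * Q = 1\<^sub>m n"
  shows "P * mat_diag n (\<lambda>_. a :: real) * Q = a \<cdot>\<^sub>m 1\<^sub>m n"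
proof (rule eq_matI)
  fix i j
  assume "i < dim_row (a \<cdot>\<^sub>m 1\<^sub>m n)" "j < dim_col (a \<cdot>\<^sub>m (1\<^sub>m n :: real mat))"
  then have ij: "i < n" "j < n"
    by simp_all
  have "(P * Q) $$ (i, j) = (\<Sum>k<n. P $$ (i, k) * Q $$ (k, j))"
    using ij P Q by (simp add: scalar_prod_def atLeast0LessThan)
  then show "(P * mat_diag n (\<lambda>_. a) * Q) $$ (i, j) = (a \<cdot>\<^sub>m 1\<^sub>m n) $$ (i, j)"
    using ij by (simp add: conj_mat_diag_index[OF P Q] PQ sum_distrib_left mult_ac flip: sum_distrib_left)
qed (use P Q in simp_all)

lemma conj_mat_diag_mult:
  assumes P: "P \<in> carrier_mat n n" and Q: "Q \<in> carrier_mat n n" and QP: "Q * P = 1\<^sub>m n"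
  shows "(P * mat_diag n f * Q) * (P * mat_diag n g * Q) = P * mat_diag n (\<lambda>i. f i * (g i :: real)) * Q"
proof -
  let ?F = "mat_diag n f" and ?G = "mat_diag n g"
  have F: "?F \<in> carrier_mat n n" and G: "?G \<in> carrier_mat n n"
    by auto
  have PF: "P * ?F \<in> carrier_mat n n" and GQ: "?G * Q \<in> carrier_mat n n"
    using mult_carrier_mat[OF P F] mult_carrier_mat[OF G Q] .
  have "(P * ?F * Q) * (P * ?G * Q) = (P * ?F) * (Q * (P * (?G * Q)))"
    unfolding assoc_mult_mat[OF P G Q] by (rule assoc_mult_mat[OF PF Q mult_carrier_mat[OF P GQ]])
  also have "\<dots> = (P * ?F) * (?G * Q)"
    using left_mult_one_mat[OF GQ] by (simp only: assoc_mult_mat[OF Q P GQ, symmetric] QP)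
  also have "\<dots> = P * (?F * ?G) * Q"
    by (simp only: assoc_mult_mat[OF PF G Q, symmetric] assoc_mult_mat[OF P F G])
  also have "?F * ?G = mat_diag n (\<lambda>i. f i * g i)"
    by simp
  finally show ?thesis .
qed

section \<open>Realizations of the complement of the path\<close>

lemma compl_path_edge_iff:
  assumes "i \<in> {1..n}" "j \<in> {1..n}" "i \<noteq> j"
  shows "{i, j} \<in> compl_edges n (path_edges n) \<longleftrightarrow> j \<noteq> Suc i \<and> i \<noteq> Suc j"
proof -
  have "{i, j} \<in> path_edges n \<longleftrightarrow> j = Suc i \<or> i = Suc j"
    using assms by (auto simp: path_edges_def doubleton_eq_iff)
  then show ?thesis
    using assms by (auto simp: compl_edges_def)
qed

text \<open>Shifting vertices to indices from 0 keeps consecutive pairs consecutive, and symmetry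
  leaves only the entries above the diagonal. This is the form of
  \<open>path_orthogonal\<close>.\<close>

lemma realizations_compl_path_iff:
  "A \<in> realizations n (compl_edges n (path_edges n)) \<longleftrightarrow>
     A \<in> carrier_mat n n \<and> transpose_mat A = A \<and>
     (\<forall>j<n. \<forall>i<j. A $$ (i, j) = 0 \<longleftrightarrow> j = Suc i)"
proof (cases "A \<in> carrier_mat n n \<and> transpose_mat A = A")
  case True
  then have sym: "A $$ (i, j) = A $$ (j, i)" if "i < n" "j < n" for i j
    using that transpose_mat_index by blast
  have "(\<forall>i\<in>{1..n}. \<forall>j\<in>{1..n}. i \<noteq> j \<longrightarrow> (A $$ (i - 1, j - 1) \<noteq> 0 \<longleftrightarrow> {i, j} \<in> compl_edges n (path_edges n)))
      \<longleftrightarrow> (\<forall>j<n. \<forall>i<j. A $$ (i, j) = 0 \<longleftrightarrow> j = Suc i)" (is "?L \<longleftrightarrow> ?R")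
  proof
    assume L: ?L
    show ?R
    proof (intro allI impI)
      fix i j
      assume "j < n" "i < j"
      then show "A $$ (i, j) = 0 \<longleftrightarrow> j = Suc i"
        using bspec[OF bspec[OF L, of "Suc i"], of "Suc j"] compl_path_edge_iff[of "Suc i" n "Suc j"] by auto
    qed
  next
    assume R: ?R
    show ?L
    proof (intro ballI impI)
      fix i j
      assume ij: "i \<in> {1..n}" "j \<in> {1..n}" "i \<noteq> j"
      have "A $$ (i - 1, j - 1) = 0 \<longleftrightarrow> j = Suc i \<or> i = Suc j"
      proof (cases "i < j")
        case True
        then show ?thesis
          using R[rule_format, of "j - 1" "i - 1"] ij by auto
      next
        case False
        then show ?thesis
          using R[rule_format, of "i - 1" "j - 1"] ij sym[of "i - 1" "j - 1"] by auto
      qed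
      then show "A $$ (i - 1, j - 1) \<noteq> 0 \<longleftrightarrow> {i, j} \<in> compl_edges n (path_edges n)"
        using compl_path_edge_iff[OF ij] by simp
    qed
  qed
  then show ?thesis
    using True by (simp add: realizations_def)
qed (auto simp: realizations_def)

section \<open>Lower bounds for the rank and the multiplicities\<close>

text \<open>P equals P times its transpose, so a diagonal entry is the sum of the squares of its
  row. This supplies the diagonal entries of the minor, on which \<open>realizations\<close> imposes
  no condition.\<close>

lemma projection_diagonal:
  assumes P: "orthogonal_projection n P" and "i < n" "j < n" "P $$ (i, j) \<noteq> 0"
  shows "P $$ (i, i) \<noteq> 0"
proof -
  have C: "P \<in> carrier_mat n n" and sym: "transpose_mat P = P" and PP: "P * P = P"
    using P by (simp_all add: orthogonal_projection_def)
  have "P $$ (i, i) = (P * P) $$ (i, i)"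
    by (simp add: PP)
  also have "\<dots> = (\<Sum>k<n. P $$ (i, k) * P $$ (k, i))"
    using C \<open>i < n\<close> by (simp add: scalar_prod_def atLeast0LessThan)
  also have "\<dots> = (\<Sum>k<n. (P $$ (i, k))\<^sup>2)"
    using transpose_mat_index[OF sym C _ \<open>i < n\<close>] by (intro sum.cong) (simp_all add: power2_eq_square)
  also have "\<dots> > 0"
    using assms by (intro sum_pos2[of _ j]) auto
  finally show ?thesis
    by simp
qed

lemma projection_rank_ge_3:
  assumes R: "P \<in> realizations n (compl_edges n (path_edges n))"
    and P: "orthogonal_projection n P" and n: "n \<ge> 4"
  shows "vec_space.rank n P \<ge> 3"
proof -
  have C: "P \<in> carrier_mat n n" and sym: "transpose_mat P = P"
    and pat: "\<And>i j. j < n \<Longrightarrow> i < j \<Longrightarrow> P $$ (i, j) = 0 \<longleftrightarrow> j = Suc i"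
    using R by (simp_all add: realizations_compl_path_iff)
  have "P $$ (1, 3) \<noteq> 0" "P $$ (0, 2) \<noteq> 0"
    using n by (simp_all add: pat)
  moreover have "P $$ (2, 0) = P $$ (0, 2)" "P $$ (2, 1) = P $$ (1, 2)"
    using n by (intro transpose_mat_index[OF sym C]; simp)+
  ultimately have "P $$ (1, 1) \<noteq> 0" "P $$ (2, 2) \<noteq> 0"
    using n projection_diagonal[OF P, of 1 3] projection_diagonal[OF P, of 2 0] by simp_all
  then show ?thesis
    using n \<open>P $$ (2, 1) = P $$ (1, 2)\<close> pat by (intro rank_ge_3_of_path_zeros[OF C n]) auto
qed

text \<open>E = (A - a I) / (b - a) is the projection onto the eigenspace of b. Off the diagonal it
  has the zero pattern of A, so its rank is at least 3, and its rank is at most the multiplicity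
  k.\<close>

lemma achievable_path_compl_ge_3:
  assumes n: "n \<ge> 4" and ach: "achievable n (compl_edges n (path_edges n)) k"
  shows "k \<ge> 3"
proof -
  obtain A a b where A: "A \<in> realizations n (compl_edges n (path_edges n))" and ab: "a \<noteq> b"
    and spec: "spectrum A = {a, b}" and ord: "Polynomial.order b (char_poly A) = k"
    using ach by (auto simp: achievable_def)
  have C: "A \<in> carrier_mat n n" and sym: "transpose_mat A = A"
    and pat: "\<And>i j. j < n \<Longrightarrow> i < j \<Longrightarrow> A $$ (i, j) = 0 \<longleftrightarrow> j = Suc i"
    using A by (simp_all add: realizations_compl_path_iff)
  obtain P Q d where PQ: "P \<in> carrier_mat n n" "Q \<in> carrier_mat n n" "P * Q = 1\<^sub>m n" "Q * P = 1\<^sub>m n"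
    and A_eq: "A = P * mat_diag n d * Q" and d: "\<forall>e. Polynomial.order e (char_poly A) = card {i. i < n \<and> d i = e}"
    using symmetric_diagonalizable[OF C sym] .
  have d_ab: "d i = a \<or> d i = b" if "i < n" for i
    using spectrum_eq_diagonal[OF C d] spec that by blast
  \<comment> \<open>The diagonal form of E gives idempotence and the rank bound; the affine formula
    \<open>E_index\<close> gives symmetry and the zero pattern.\<close>
  define f where "f i = (if d i = b then 1 else 0 :: real)" for i
  define E where "E = P * mat_diag n f * Q"
  have E: "E \<in> carrier_mat n n"
    using PQ by (simp add: E_def mult_carrier_mat[of _ n n])
  have E_index: "E $$ (r, c) = (A $$ (r, c) - (if r = c then a else 0)) / (b - a)" if rc: "r < n" "c < n" for r c
  proof -
    have "(b - a) * E $$ (r, c) = (\<Sum>i<n. P $$ (r, i) * ((b - a) * f i) * Q $$ (i, c))"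
      unfolding E_def conj_mat_diag_index[OF PQ(1,2) rc] by (simp add: sum_distrib_left mult_ac)
    also have "\<dots> = (\<Sum>i<n. P $$ (r, i) * d i * Q $$ (i, c) - P $$ (r, i) * a * Q $$ (i, c))"
      using d_ab by (intro sum.cong) (auto simp: f_def algebra_simps)
    also have "\<dots> = A $$ (r, c) - (P * mat_diag n (\<lambda>_. a) * Q) $$ (r, c)"
      unfolding A_eq conj_mat_diag_index[OF PQ(1,2) rc] by (simp add: sum_subtractf)
    also have "\<dots> = A $$ (r, c) - (if r = c then a else 0)"
      using rc by (simp add: conj_mat_diag_const[OF PQ(1-3)])
    finally show ?thesis
      using ab by (simp add: field_simps)
  qed
  have symE: "transpose_mat E = E"
    using E transpose_mat_index[OF sym C] by (intro eq_matI) (auto simp: E_index)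
  have "(\<lambda>i. f i * f i) = f"
    by (auto simp: f_def)
  then have "E * E = E"
    unfolding E_def conj_mat_diag_mult[OF PQ(1,2,4)] by simp
  then have "orthogonal_projection n E"
    using E symE by (simp add: orthogonal_projection_def)
  moreover have "E \<in> realizations n (compl_edges n (path_edges n))"
    using E symE pat ab by (auto simp: realizations_compl_path_iff E_index)
  ultimately have "3 \<le> vec_space.rank n E"
    using projection_rank_ge_3 n by blast
  also have "\<dots> \<le> card {i. i < n \<and> d i = b}"
  proof (rule vec_space.rank_le_card_rank_one_summands[OF _ E])
    show "E $$ (r, c) = (\<Sum>i\<in>{i. i < n \<and> d i = b}. P $$ (r, i) * Q $$ (i, c))" if "r < n" "c < n" for r c
      unfolding E_def conj_mat_diag_index[OF PQ(1,2) that] f_def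
      by (rule sum.mono_neutral_cong_right) auto
  qed simp
  finally show ?thesis
    by (simp add: d flip: ord)
qed

text \<open>A diagonalizable matrix with a single eigenvalue is scalar, but the entry (0, 2) is
  nonzero.\<close>

lemma q_mat_ge_2:
  assumes n: "n \<ge> 3" and A: "A \<in> realizations n (compl_edges n (path_edges n))"
  shows "q_mat A \<ge> 2"
proof -
  have C: "A \<in> carrier_mat n n" and sym: "transpose_mat A = A"
    and pat: "\<And>i j. j < n \<Longrightarrow> i < j \<Longrightarrow> A $$ (i, j) = 0 \<longleftrightarrow> j = Suc i"
    using A by (simp_all add: realizations_compl_path_iff)
  obtain P Q d where PQ: "P \<in> carrier_mat n n" "Q \<in> carrier_mat n n" "P * Q = 1\<^sub>m n" "Q * P = 1\<^sub>m n"
    and A_eq: "A = P * mat_diag n d * Q" and d: "\<forall>e. Polynomial.order e (char_poly A) = card {i. i < n \<and> d i = e}"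
    using symmetric_diagonalizable[OF C sym] .
  have spec: "spectrum A = d ` {..<n}"
    by (rule spectrum_eq_diagonal[OF C d])
  show ?thesis
  proof (rule ccontr)
    assume "\<not> ?thesis"
    then have "card (spectrum A) \<le> 1"
      by (simp add: q_mat_def)
    moreover have "finite (spectrum A)"
      by (simp add: spec)
    ultimately have "\<forall>x\<in>spectrum A. \<forall>y\<in>spectrum A. x = y"
      by (metis One_nat_def card_le_Suc0_iff_eq)
    then obtain c where "\<forall>x\<in>spectrum A. x = c"
      by blast
    then have diag: "mat_diag n d = mat_diag n (\<lambda>_. c)"
      by (intro eq_matI) (auto simp: mat_diag_def spec)
    have "A = c \<cdot>\<^sub>m 1\<^sub>m n"
      by (simp only: A_eq diag conj_mat_diag_const[OF PQ(1-3)])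
    then have "A $$ (0, 2) = 0"
      using n by simp
    then show False
      using pat[of 2 0] n by simp
  qed
qed

section \<open>The projection of rank three and its spectrum\<close>

text \<open>P is the Gram matrix U U^T of the frame with rows u i. The trace is recorded because
  \<open>projection_spectrum\<close> obtains the multiplicities from it.\<close>

lemma exists_projection_rank_3:
  assumes n: "n \<ge> 6"
  obtains P where "P \<in> realizations n (compl_edges n (path_edges n))" "orthogonal_projection n P"
    "vec_space.rank n P = 3" "(\<Sum>i<n. P $$ (i, i)) = 3"
proof -
  obtain u where u: "path_orthogonal n u"
    and tight: "\<And>r s. r < 3 \<Longrightarrow> s < 3 \<Longrightarrow> (\<Sum>i<n. u i r * u i s) = (if r = s then 1 else 0)"
    using exists_tight_frame[OF n] by blast
  define P where "P = mat n n (\<lambda>(i, j). dot3 (u i) (u j))"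
  have P: "P \<in> carrier_mat n n"
    by (simp add: P_def)
  have sym: "transpose_mat P = P"
    by (intro eq_matI) (auto simp: P_def dot3_commute)
  have dot: "dot3 v w = (\<Sum>r<3. v r * w r)" for v w
    by (simp add: dot3_def eval_nat_numeral)
  have "P * P = P"
  proof (rule eq_matI)
    fix i j
    assume "i < dim_row P" "j < dim_col P"
    then have ij: "i < n" "j < n"
      using P by simp_all
    have "(P * P) $$ (i, j) = (\<Sum>k<n. dot3 (u i) (u k) * dot3 (u k) (u j))"
      using ij by (simp add: P_def scalar_prod_def atLeast0LessThan)
    \<comment> \<open>P P = U (U^T U) U^T: the sum over k is moved innermost, where tightness makes
      U^T U the identity.\<close>
    also have "\<dots> = (\<Sum>k<n. \<Sum>r<3. \<Sum>s<3. u i r * u j s * (u k r * u k s))"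
      unfolding dot by (simp add: sum_product mult_ac)
    also have "\<dots> = (\<Sum>r<3. \<Sum>k<n. \<Sum>s<3. u i r * u j s * (u k r * u k s))"
      by (rule sum.swap)
    also have "\<dots> = (\<Sum>r<3. \<Sum>s<3. \<Sum>k<n. u i r * u j s * (u k r * u k s))"
      by (intro sum.cong refl sum.swap)
    also have "\<dots> = (\<Sum>r<3. \<Sum>s<3. u i r * u j s * (if r = s then 1 else 0))"
      by (simp add: tight flip: sum_distrib_left)
    also have "\<dots> = P $$ (i, j)"
      using ij by (simp add: P_def dot if_distrib cong: if_cong)
    finally show "(P * P) $$ (i, j) = P $$ (i, j)" .
  qed (use P in simp_all)
  then have proj: "orthogonal_projection n P"
    using P sym by (simp add: orthogonal_projection_def)
  have real: "P \<in> realizations n (compl_edges n (path_edges n))"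
    using u P sym by (auto simp: realizations_compl_path_iff P_def path_orthogonal_def)
  have "vec_space.rank n P \<le> card {..<3::nat}"
    by (rule vec_space.rank_le_card_rank_one_summands[OF _ P, where f = "\<lambda>r i. u i r" and g = "\<lambda>r i. u i r"])
      (simp_all add: P_def dot)
  then have "vec_space.rank n P = 3"
    using projection_rank_ge_3[OF real proj] n by simp
  moreover have "(\<Sum>i<n. P $$ (i, i)) = (\<Sum>r<3. \<Sum>i<n. u i r * u i r)"
    by (subst sum.swap) (simp add: P_def dot)
  then have "(\<Sum>i<n. P $$ (i, i)) = 3"
    by (simp add: tight)
  ultimately show thesis
    using that real proj by blast
qed

text \<open>Idempotence forces eigenvalues 0 and 1, so the trace counts the ones. The bounds on k
  ensure that both values occur.\<close>

lemma projection_spectrum: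
  assumes proj: "orthogonal_projection n A" and tr: "(\<Sum>i<n. A $$ (i, i)) = real k"
    and k: "0 < k" "k < n"
  shows "spectrum A = {0, 1}" "Polynomial.order 0 (char_poly A) = n - k" "Polynomial.order 1 (char_poly A) = k"
proof -
  have C: "A \<in> carrier_mat n n" and sym: "transpose_mat A = A" and AA: "A * A = A"
    using proj by (simp_all add: orthogonal_projection_def)
  obtain P Q d where PQ: "P \<in> carrier_mat n n" "Q \<in> carrier_mat n n" "P * Q = 1\<^sub>m n" "Q * P = 1\<^sub>m n"
    and A_eq: "A = P * mat_diag n d * Q" and d: "\<forall>e. Polynomial.order e (char_poly A) = card {i. i < n \<and> d i = e}"
    using symmetric_diagonalizable[OF C sym] .
  have QP_index: "(\<Sum>j<n. Q $$ (i, j) * P $$ (j, i)) = 1" if "i < n" for i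
  proof -
    have "(Q * P) $$ (i, i) = 1"
      using that PQ(4) by simp
    then show ?thesis
      using that PQ(1,2) by (simp add: scalar_prod_def atLeast0LessThan)
  qed
  have spec: "spectrum A = d ` {..<n}"
    by (rule spectrum_eq_diagonal[OF C d])
  have d01: "d i = 0 \<or> d i = 1" if i: "i < n" for i
  proof -
    have "eigenvalue A (d i)"
      using spec i by (auto simp: spectrum_def)
    then obtain v where v: "v \<in> carrier_vec n" "v \<noteq> 0\<^sub>v n" and Av: "A *\<^sub>v v = d i \<cdot>\<^sub>v v"
      using C by (auto simp: eigenvalue_def eigenvector_def)
    have "d i \<cdot>\<^sub>v v = (A * A) *\<^sub>v v"
      by (simp only: AA Av)
    also have "\<dots> = A *\<^sub>v (d i \<cdot>\<^sub>v v)"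
      by (simp only: assoc_mult_mat_vec[OF C C v(1)] Av)
    also have "\<dots> = (d i * d i) \<cdot>\<^sub>v v"
      by (simp only: mult_mat_vec[OF C v(1)] Av smult_smult_assoc)
    finally have eq: "d i \<cdot>\<^sub>v v = (d i * d i) \<cdot>\<^sub>v v" .
    obtain j where j: "j < n" "v $ j \<noteq> 0"
      using v by (metis carrier_vecD eq_vecI index_zero_vec)
    then show ?thesis
      using arg_cong[OF eq, of "\<lambda>w. w $ j"] v by auto
  qed
  \<comment> \<open>Invariance of the trace under similarity, written out by exchanging the two sums
    and using Q P = 1.\<close>
  have "real k = (\<Sum>r<n. \<Sum>i<n. P $$ (r, i) * d i * Q $$ (i, r))"
    unfolding tr[symmetric] A_eq by (intro sum.cong refl conj_mat_diag_index[OF PQ(1,2)]) auto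
  also have "\<dots> = (\<Sum>i<n. d i * (\<Sum>r<n. Q $$ (i, r) * P $$ (r, i)))"
    by (subst sum.swap) (simp add: sum_distrib_left mult_ac)
  also have "\<dots> = (\<Sum>i<n. d i)"
    by (simp add: QP_index)
  also have "\<dots> = (\<Sum>i\<in>{i. i < n \<and> d i = 1}. 1)"
    using d01 by (intro sum.mono_neutral_cong_right) auto
  finally have card_1: "card {i. i < n \<and> d i = 1} = k"
    by simp
  moreover have "{i. i < n \<and> d i = 0} = {..<n} - {i. i < n \<and> d i = 1}"
    using d01 by auto
  ultimately have card_0: "card {i. i < n \<and> d i = 0} = n - k"
    by (simp add: card_Diff_subset subset_iff)
  show "Polynomial.order 0 (char_poly A) = n - k" "Polynomial.order 1 (char_poly A) = k"
    by (simp_all only: d card_0 card_1)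
  have "{i. i < n \<and> d i = 0} \<noteq> {}" "{i. i < n \<and> d i = 1} \<noteq> {}"
    using card_0 card_1 k by (metis card.empty neq0_conv zero_less_diff)+
  then show "spectrum A = {0, 1}"
    using d01 by (force simp: spec)
qed

theorem theorem1p1:
  fixes n :: nat
  assumes "n \<ge> 6"
  shows "(q_graph n (compl_edges n (path_edges n)) = 2 \<and>
          MB n (compl_edges n (path_edges n)) = 3) \<and>
         (\<exists>P \<in> realizations n (compl_edges n (path_edges n)).
            orthogonal_projection n P \<and> vec_space.rank n P = 3) \<and>
         \<not> (\<exists>P \<in> realizations n (compl_edges n (path_edges n)).
            orthogonal_projection n P \<and> vec_space.rank n P \<in> {1, 2})"
proof (intro conjI)
  let ?E = "compl_edges n (path_edges n)"
  obtain P where P: "P \<in> realizations n ?E" "orthogonal_projection n P" "vec_space.rank n P = 3"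
    and tr: "(\<Sum>i<n. P $$ (i, i)) = 3"
    using exists_projection_rank_3[OF assms] .
  note spec = projection_spectrum[OF P(2), of 3]
  have "spectrum P = {0, 1}"
    using spec tr assms by simp
  then have "q_mat P = 2"
    by (simp add: q_mat_def)
  then show "q_graph n ?E = 2"
    unfolding q_graph_def using P q_mat_ge_2[of n] assms by (intro Least_equality) auto
  have "achievable n ?E 3"
    \<comment> \<open>Here a = 0 and b = 1, so b has multiplicity 3; the bound 3 <= n div 2 uses n
      >= 6.\<close>
    unfolding achievable_def using assms spec tr P(1) by (intro conjI bexI[of _ P] exI[of _ 0] exI[of _ 1]) auto
  then show "MB n ?E = 3"
    unfolding MB_def using achievable_path_compl_ge_3[of n] assms by (intro Least_equality) auto
  show "\<exists>P\<in>realizations n ?E. orthogonal_projection n P \<and> vec_space.rank n P = 3"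
    using P by blast
  show "\<not> (\<exists>P\<in>realizations n ?E. orthogonal_projection n P \<and> vec_space.rank n P \<in> {1, 2})"
    using projection_rank_ge_3 assms by fastforce
qed
end
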